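(* Let $\Omega\subset\mathbb{R}$ be a symmetric (i.e. $\Omega=-\Omega$) finite union of bounded open intervals with $0\in\operatorname{int}\Omega$. Suppose that every boundary point of $\Omega$ belongs to $q^{-1}\mathbb{Z}$ for some integer $q\ge1$ (the same $q$ for all boundary points). Then $$\mathcal{T}_{\mathbb{R}}(\Omega)=\frac1q\,\mathcal{T}_{\mathbb{Z}}\left(\left\{n\in\mathbb{Z}:\frac nq\in\operatorname{int}\Omega\right\}\right).$$
   Context: A function $f:\mathbb{R}\to\mathbb{C}$ is positive definite if $\sum_{j,k=1}^m z_j\overline{z_k}f(x_j-x_k)\ge 0$ for all finite choices of $x_1,\dots,x_m\in\mathbb{R}$ and $z_1,\dots,z_m\in\mathbb{C}$. For an open bounded set $\Omega\subset\mathbb{R}$ with $\Omega=-\Omega$ and $0\in\Omega$, the Turán constant is $$\mathcal{T}_{\mathbb{R}}(\Omega)=\sup\left\{\int_{\mathbb{R}}f(x)\,dx: f\in C(\mathbb{R}),\ f \text{ positive definite},\ f(0)=1,\ \operatorname{supp} f\subset\Omega\right\},$$ where $\operatorname{supp} f$ is the closed support of $f$ (the integrals in question are automatically real). A complex sequence $(c_n)_{n\in\mathbb{Z}}$ is positive definite if $\sum_{j,k=1}^r z_j\overline{z_k}c_{m_j-m_k}\ge0$ for every finite set $\{m_1,\dots,m_r\}\subset\mathbb{Z}$ and all $z_1,\dots,z_r\in\mathbb{C}$. For a finite set $A\subset\mathbb{Z}$ with $A=-A$ and $0\in A$, the discrete Turán constant is $$\mathcal{T}_{\mathbb{Z}}(A)=\sup\left\{\sum_{n\in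 A}c_n:(c_n)_{n\in\mathbb{Z}}\text{ positive definite},\ c_0=1,\ c_n=0\text{ for }n\notin A\right\}$$ (the sums in question are automatically real). *)

theory Defs
  imports "HOL-Analysis.Analysis"
begin

definition positive_definite_fun :: "(real \<Rightarrow> complex) \<Rightarrow> bool" where
  "positive_definite_fun f \<longleftrightarrow>
     (\<forall>(m::nat) (x :: nat \<Rightarrow> real) (z :: nat \<Rightarrow> complex).
        (\<Sum>j<m. \<Sum>k<m. z j * cnj (z k) * f (x j - x k)) \<in> \<real>\<^sub>\<ge>\<^sub>0)"

definition positive_definite_seq :: "(int \<Rightarrow> complex) \<Rightarrow> bool" where
  "positive_definite_seq c \<longleftrightarrow>
     (\<forall>(M :: int set) (z :: int \<Rightarrow> complex). finite M \<longrightarrow>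
        (\<Sum>m\<in>M. \<Sum>n\<in>M. z m * cnj (z n) * c (m - n)) \<in> \<real>\<^sub>\<ge>\<^sub>0)"

text \<open>
  Positive definiteness and symmetry force the integrals (resp. sums) below to be real, so taking
  \<^term>\<open>Re\<close> only changes the type. For a bounded open symmetric \<open>\<Omega>\<close> containing 0
  (resp. a finite symmetric \<open>A\<close> containing 0) the set of values is nonempty and bounded above,
  so the conditionally complete \<^const>\<open>Sup\<close> on the reals is the genuine supremum.
\<close>

definition turan_real :: "real set \<Rightarrow> real" where
  "turan_real \<Omega> =
     Sup {Re (LINT x|lborel. f x) | f :: real \<Rightarrow> complex.
            continuous_on UNIV f \<and> positive_definite_fun f \<and> f 0 = 1 \<and>
            closure {x. f x \<noteq> 0} \<subseteq> \<Omega>}"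

definition turan_int :: "int set \<Rightarrow> real" where
  "turan_int A =
     Sup {Re (\<Sum>n\<in>A. c n) | c :: int \<Rightarrow> complex.
            positive_definite_seq c \<and> c 0 = 1 \<and> (\<forall>n. n \<notin> A \<longrightarrow> c n = 0)}"

end

theory Submission
  imports Defs
begin

text \<open>
  Write \<open>A\<close> for the integers \<open>n\<close> with \<open>n / q \<in> \<Omega>\<close>. Admissible functions on the line and
  admissible sequences on \<open>A\<close> are turned into each other by sampling and by interpolation.

  Sampling. For an admissible \<open>f\<close> the sequence \<open>c n = f (n / q)\<close> is admissible. Its sum is the value
  at 0 of the periodization \<open>F t = (\<Sum>n. f (n / q + t))\<close>, which is positive definite on the circle of
  length \<open>1 / q\<close> and therefore has \<open>Re (F t) \<le> F 0\<close>. Integrating over one period gives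
  \<open>(\<integral>f) \<le> (\<Sum>n. c n) / q\<close> (lemma \<open>integral_le_lattice_sum\<close>).

  Interpolation. For an admissible \<open>c\<close>, place the multiple \<open>c n\<close> of a triangle of height 1 and
  half-width \<open>w / q\<close> at each point \<open>n / q\<close>. The triangle is a correlation of the indicator of an
  interval with itself, so the result inherits positive definiteness from \<open>c\<close> (lemma
  \<open>positive_definite_fun_interpolation\<close>), and its integral is \<open>w / q\<close> times the sum of \<open>c\<close>. Since
  all boundary points of \<open>\<Omega>\<close> lie on the lattice, the open interval of radius \<open>1 / q\<close> around each
  \<open>n / q \<in> \<Omega>\<close> stays in \<open>\<Omega>\<close> (lemma \<open>lattice_cell_subset\<close>). A half-width strictly below \<open>1 / q\<close>
  keeps the closed support inside \<open>\<Omega>\<close>, and \<open>w \<rightarrow> 1\<close> gives the reverse inequality of the suprema;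
  the supremum itself need not be attained.

  Both directions need a single sum over the whole lattice to be nonnegative, whereas positive
  definiteness is about double sums over finite sets of points. The passage from the latter to the
  former is
  \<open>sum_nonneg_if_Toeplitz_sums_nonneg\<close>.
\<close>

section \<open>Finitely supported Toeplitz kernels\<close>

lemma Toeplitz_sum_Suc:
  fixes g :: "int \<Rightarrow> complex"
  shows "(\<Sum>j<Suc N. \<Sum>k<Suc N. g (int j - int k)) =
         (\<Sum>j<N. \<Sum>k<N. g (int j - int k)) + (\<Sum>n\<in>{- int N..int N}. g n)"
proof -
  have "{- int N..int N} = (\<lambda>k. int N - int k) ` {..<N} \<union> (\<lambda>j. int j - int N) ` {..<N} \<union> {0}"
  proof (intro equalityI subsetI)
    fix n assume n: "n \<in> {- int N..int N}"
    consider "n = 0" | "n > 0" | "n < 0" by linarith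
    then show "n \<in> (\<lambda>k. int N - int k) ` {..<N} \<union> (\<lambda>j. int j - int N) ` {..<N} \<union> {0}"
    proof cases
      case 2
      then have "n = int N - int (nat (int N - n))" "nat (int N - n) < N" using n by auto
      then show ?thesis by blast
    next
      case 3
      then have "n = int (nat (int N + n)) - int N" "nat (int N + n) < N" using n by auto
      then show ?thesis by blast
    qed auto
  qed auto
  then have "(\<Sum>n\<in>{- int N..int N}. g n) =
      (\<Sum>n\<in>(\<lambda>k. int N - int k) ` {..<N} \<union> (\<lambda>j. int j - int N) ` {..<N} \<union> {0}. g n)"
    by simp
  also have "\<dots> = (\<Sum>n\<in>(\<lambda>k. int N - int k) ` {..<N}. g n)
               + (\<Sum>n\<in>(\<lambda>j. int j - int N) ` {..<N}. g n) + g 0"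
    by (subst sum.union_disjoint; (subst sum.union_disjoint)?; force)
  also have "\<dots> = (\<Sum>k<N. g (int N - int k)) + (\<Sum>j<N. g (int j - int N)) + g 0"
    by (simp add: sum.reindex inj_on_def)
  finally show ?thesis
    by (simp add: sum.distrib)
qed

text \<open>
  Once \<open>N\<close> exceeds the support of \<open>g\<close>, enlarging \<open>N\<close> by one adds exactly \<open>\<Sum>n. g n\<close> to the Toeplitz
  sum, so the Toeplitz sums grow linearly with that slope; a slope that is not a nonnegative real
  would contradict their nonnegativity.
\<close>
lemma sum_nonneg_if_Toeplitz_sums_nonneg:
  fixes g :: "int \<Rightarrow> complex"
  assumes fin: "finite S" and supp: "\<And>n. n \<notin> S \<Longrightarrow> g n = 0"
    and nonneg: "\<And>N. (\<Sum>j<N. \<Sum>k<N. g (int j - int k)) \<in> \<real>\<^sub>\<ge>\<^sub>0"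
  shows "(\<Sum>n\<in>S. g n) \<in> \<real>\<^sub>\<ge>\<^sub>0"
proof -
  define D where "D N = (\<Sum>j<N. \<Sum>k<N. g (int j - int k))" for N
  define s where "s = (\<Sum>n\<in>S. g n)"
  obtain K :: nat where K: "S \<subseteq> {- int K..int K}"
  proof -
    have "finite (abs ` S)" using fin by simp
    then obtain B where B: "\<And>n. n \<in> S \<Longrightarrow> \<bar>n\<bar> \<le> B"
      using bdd_above_finite[of "abs ` S"]
      by (auto simp: bdd_above_def)
    have "S \<subseteq> {- int (nat B)..int (nat B)}" using B by fastforce
    then show ?thesis using that by blast
  qed
  have step: "D (Suc N) = D N + s" if "K \<le> N" for N
  proof -
    have "s = (\<Sum>n\<in>{- int N..int N}. g n)"
      unfolding s_def using K that supp by (intro sum.mono_neutral_left) auto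
    then show ?thesis unfolding D_def by (simp only: Toeplitz_sum_Suc)
  qed
  have lin: "D (K + N) = D K + of_nat N * s" for N
    by (induction N) (simp_all add: step algebra_simps)
  have D: "Re (D N) \<ge> 0" "Im (D N) = 0" for N
    using nonneg[of N] by (auto simp: D_def complex_nonneg_Reals_iff)
  have "Im s = 0" using step[of K] D(2)[of K] D(2)[of "Suc K"] by simp
  moreover have "Re s \<ge> 0"
  proof (rule ccontr)
    assume "\<not> Re s \<ge> 0"
    then obtain N where "Re (D K) < real N * (- Re s)"
      using reals_Archimedean3[of "- Re s"] by auto
    then show False using arg_cong[OF lin[of N], of Re] D(1)[of "K + N"] by simp
  qed
  ultimately show ?thesis by (simp add: s_def complex_nonneg_Reals_iff)
qed

section \<open>Positive definite functions and sequences\<close>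

text \<open>Arbitrary finite index sets in place of \<open>{..<m}\<close>: the test points used for sampling form two
  copies of a segment of the lattice, and are indexed by pairs.\<close>
lemma positive_definite_fun_sum_nonneg:
  assumes f: "positive_definite_fun f" and fin: "finite I"
  shows "(\<Sum>i\<in>I. \<Sum>j\<in>I. z i * cnj (z j) * f (x i - x j)) \<in> \<real>\<^sub>\<ge>\<^sub>0"
proof -
  obtain e where e: "bij_betw e {0..<card I} I"
    using ex_bij_betw_nat_finite[OF fin] by blast
  then have e: "bij_betw e {..<card I} I" by (simp add: atLeast0LessThan)
  have "(\<Sum>i\<in>I. \<Sum>j\<in>I. z i * cnj (z j) * f (x i - x j)) =
    (\<Sum>i<card I. \<Sum>j<card I. z (e i) * cnj (z (e j)) * f (x (e i) - x (e j)))"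
    by (simp add: sum.reindex_bij_betw[OF e, symmetric])
  then show ?thesis
    using f[unfolded positive_definite_fun_def, rule_format, of "z \<circ> e" "x \<circ> e" "card I"] by simp
qed

lemma positive_definite_seq_sample:
  assumes "positive_definite_fun f"
  shows "positive_definite_seq (\<lambda>n. f (real_of_int n / h))"
  unfolding positive_definite_seq_def
proof (intro allI impI)
  fix M :: "int set" and z :: "int \<Rightarrow> complex"
  assume "finite M"
  from positive_definite_fun_sum_nonneg[OF assms this, of z "\<lambda>n. real_of_int n / h"]
  show "(\<Sum>m\<in>M. \<Sum>n\<in>M. z m * cnj (z n) * f (real_of_int (m - n) / h)) \<in> \<real>\<^sub>\<ge>\<^sub>0"
    by (simp add: diff_divide_distrib)
qed

text \<open>The test vector with entries \<open>1\<close> at \<open>0\<close> and \<open>-1\<close> at \<open>n\<close>. Pairing \<open>n\<close> with \<open>-n\<close> is what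
  bounds sums over symmetric sets.\<close>
lemma positive_definite_seq_Re_le:
  assumes "positive_definite_seq c"
  shows "Re (c n) + Re (c (- n)) \<le> 2 * Re (c 0)"
proof (cases "n = 0")
  case False
  have "(\<Sum>m\<in>{0, n}. \<Sum>k\<in>{0, n}. (if m = 0 then 1 else - 1) * cnj (if k = 0 then 1 else - 1) * c (m - k)) \<in> \<real>\<^sub>\<ge>\<^sub>0"
    using assms[unfolded positive_definite_seq_def, rule_format, of "{0, n}" "\<lambda>m. if m = 0 then 1 else - 1"]
    by simp
  then show ?thesis using False by (auto simp: complex_nonneg_Reals_iff)
qed simp

lemma positive_definite_seq_delta: "positive_definite_seq (\<lambda>n. if n = 0 then 1 else 0)"
  unfolding positive_definite_seq_def
proof (intro allI impI)
  fix M :: "int set" and z :: "int \<Rightarrow> complex"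
  assume fin: "finite M"
  have "(\<Sum>m\<in>M. \<Sum>n\<in>M. z m * cnj (z n) * (if m - n = 0 then 1 else 0)) = (\<Sum>m\<in>M. z m * cnj (z m))"
    using fin by (intro sum.cong) (auto simp: if_distrib cong: if_cong)
  also have "\<dots> \<in> \<real>\<^sub>\<ge>\<^sub>0"
    by (auto simp: complex_nonneg_Reals_iff intro!: sum_nonneg sum.neutral)
  finally show "(\<Sum>m\<in>M. \<Sum>n\<in>M. z m * cnj (z n) * (if m - n = 0 then 1 else 0)) \<in> \<real>\<^sub>\<ge>\<^sub>0" .
qed

lemma bdd_above_turan_int:
  assumes "finite A" and sym: "\<And>n. n \<in> A \<Longrightarrow> - n \<in> A"
  shows "bdd_above {Re (\<Sum>n\<in>A. c n) | c :: int \<Rightarrow> complex.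
            positive_definite_seq c \<and> c 0 = 1 \<and> (\<forall>n. n \<notin> A \<longrightarrow> c n = 0)}"
proof (rule bdd_aboveI, clarify)
  fix c assume c: "positive_definite_seq c" "c 0 = 1"
  have "bij_betw uminus A A"
    using sym by (intro bij_betw_byWitness[where f' = uminus]) auto
  then have "(\<Sum>n\<in>A. Re (c (- n))) = (\<Sum>n\<in>A. Re (c n))"
    by (rule sum.reindex_bij_betw)
  then have "2 * Re (\<Sum>n\<in>A. c n) = (\<Sum>n\<in>A. Re (c n) + Re (c (- n)))"
    by (simp add: sum.distrib)
  also have "\<dots> \<le> (\<Sum>n\<in>A. 2)"
    using positive_definite_seq_Re_le[OF c(1)] c(2) by (intro sum_mono) auto
  finally show "Re (\<Sum>n\<in>A. c n) \<le> real (card A)" by simp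
qed

section \<open>Sampling\<close>

text \<open>
  This is \<open>Re (F t) + Re (F (- t)) \<le> 2 * F 0\<close> for the periodization \<open>F\<close>. It comes from testing positive
  definiteness with weight 1 on a long segment of the lattice and weight \<open>-1\<close> on its translate by
  \<open>t\<close>: the resulting double sum is a Toeplitz sum of \<open>2 * f x - f (x + t) - f (x - t)\<close>.
\<close>
lemma lattice_sum_shift_le:
  assumes pd: "positive_definite_fun f" and "finite S"
    and supp: "\<And>n. n \<notin> S \<Longrightarrow> f (real_of_int n / q) = 0 \<and>
                 f (real_of_int n / q + t) = 0 \<and> f (real_of_int n / q - t) = 0"
  shows "(\<Sum>n\<in>S. Re (f (real_of_int n / q + t))) + (\<Sum>n\<in>S. Re (f (real_of_int n / q - t)))
           \<le> 2 * (\<Sum>n\<in>S. Re (f (real_of_int n / q)))"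
proof -
  define g where "g n = 2 * f (real_of_int n / q) - f (real_of_int n / q + t) - f (real_of_int n / q - t)" for n :: int
  have "(\<Sum>n\<in>S. g n) \<in> \<real>\<^sub>\<ge>\<^sub>0"
  proof (rule sum_nonneg_if_Toeplitz_sums_nonneg)
    fix N
    define z :: "nat \<times> bool \<Rightarrow> complex" where "z = (\<lambda>(j, b). if b then - 1 else 1)"
    define x :: "nat \<times> bool \<Rightarrow> real" where "x = (\<lambda>(j, b). real j / q + (if b then t else 0))"
    have "(\<Sum>i\<in>{..<N} \<times> UNIV. \<Sum>j\<in>{..<N} \<times> UNIV. z i * cnj (z j) * f (x i - x j)) \<in> \<real>\<^sub>\<ge>\<^sub>0"
      by (intro positive_definite_fun_sum_nonneg pd) auto
    also have "(\<Sum>i\<in>{..<N} \<times> UNIV. \<Sum>j\<in>{..<N} \<times> UNIV. z i * cnj (z j) * f (x i - x j)) =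
      (\<Sum>j<N. \<Sum>k<N. g (int j - int k))"
      unfolding sum.cartesian_product' UNIV_bool
      by (auto simp: z_def x_def g_def diff_divide_distrib sum.distrib[symmetric] algebra_simps
            intro!: sum.cong)
    finally show "(\<Sum>j<N. \<Sum>k<N. g (int j - int k)) \<in> \<real>\<^sub>\<ge>\<^sub>0" .
  qed (use assms in \<open>auto simp: g_def\<close>)
  then show ?thesis
    by (simp add: complex_nonneg_Reals_iff g_def sum.distrib sum_subtractf sum_distrib_left)
qed

text \<open>Used to unfold the integral of the periodization over one period into the integral over the
  line.\<close>
lemma sum_integral_consecutive:
  fixes f :: "real \<Rightarrow> real"
  assumes f: "continuous_on UNIV f" and h: "h \<ge> 0"
  shows "(\<Sum>i<N. integral {a + real i * h..a + real (Suc i) * h} f) = integral {a..a + real N * h} f"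
proof (induction N)
  case (Suc N)
  have "integral {a..a + real N * h} f + integral {a + real N * h..a + real (Suc N) * h} f =
        integral {a..a + real (Suc N) * h} f"
    using h by (intro Henstock_Kurzweil_Integration.integral_combine integrable_continuous_real
        continuous_on_subset[OF f]) (auto simp: algebra_simps)
  then show ?case using Suc by simp
qed simp

lemma integral_shift_Icc:
  fixes f :: "real \<Rightarrow> real"
  shows "integral {0..h} (\<lambda>t. f (a + t)) = integral {a..a + h} f"
    and "integral {0..h} (\<lambda>t. f (a - t)) = integral {a - h..a} f"
proof -
  show "integral {0..h} (\<lambda>t. f (a + t)) = integral {a..a + h} f"
    using integral_shift_Icc_real[of 0 h f a] by (simp add: o_def add.commute)
  have "integral {0..h} (\<lambda>t. f (a - t)) = integral {- h..- 0} (\<lambda>t. f (a - (- t)))"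
    by (rule Henstock_Kurzweil_Integration.integral_reflect_real[symmetric])
  also have "\<dots> = integral {- h..0} (f \<circ> (+) a)"
    by (simp only: o_def diff_minus_eq_add minus_zero)
  also have "\<dots> = integral {a - h..a} f"
    unfolding integral_shift_Icc_real by simp
  finally show "integral {0..h} (\<lambda>t. f (a - t)) = integral {a - h..a} f" .
qed

lemma integrable_continuous_compact_support:
  fixes f :: "real \<Rightarrow> 'b::euclidean_space"
  assumes "continuous_on UNIV f" and supp: "\<And>x. x \<notin> {a..b} \<Longrightarrow> f x = 0"
  shows "integrable lborel f"
proof -
  have "integrable lborel (\<lambda>x. indicator {a..b} x *\<^sub>R f x)"
    using assms by (intro borel_integrable_compact) (auto intro: continuous_on_subset)
  also have "(\<lambda>x. indicator {a..b} x *\<^sub>R f x) = f"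
    using supp by (fastforce simp: indicator_def)
  finally show ?thesis .
qed

lemma lborel_integral_compact_support:
  fixes f :: "real \<Rightarrow> 'b::euclidean_space"
  assumes cont: "continuous_on UNIV f" and supp: "\<And>x. x \<notin> {a..b} \<Longrightarrow> f x = 0"
  shows "(LINT x|lborel. f x) = integral {a..b} f"
proof -
  have "(LINT x|lborel. f x) = integral UNIV f"
    using assms by (intro integral_lborel[symmetric] integrable_continuous_compact_support)
  also have "\<dots> = integral UNIV (\<lambda>x. if x \<in> {a..b} then f x else 0)"
    using supp by (intro arg_cong[of _ _ "integral UNIV"]) fastforce
  also have "\<dots> = integral {a..b} f"
    by (rule integral_restrict_UNIV)
  finally show ?thesis .
qed

text \<open>
  The integral of the periodization over one period is the integral of \<open>f\<close> over the line, while
  \<open>lattice_sum_shift_le\<close> says that its real part is largest at 0. The set \<open>S\<close> is any finite set of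
  indices containing the lattice points of the support; the proof replaces it by a symmetric
  interval \<open>T\<close> long enough to work for all shifts \<open>t\<close> in a period simultaneously.
\<close>
lemma integral_le_lattice_sum:
  fixes f :: "real \<Rightarrow> complex"
  assumes cont: "continuous_on UNIV f" and pd: "positive_definite_fun f"
    and q: "q > 0" and supp: "\<And>x. \<bar>x\<bar> > R \<Longrightarrow> f x = 0"
    and S: "finite S" "\<And>n. n \<notin> S \<Longrightarrow> f (real_of_int n / q) = 0"
  shows "q * Re (LINT x|lborel. f x) \<le> Re (\<Sum>n\<in>S. f (real_of_int n / q))"
proof -
  define h where "h = 1 / q"
  have h: "h > 0" using q by (simp add: h_def)
  define \<phi> where "\<phi> x = Re (f x)" for x
  have cont_\<phi>: "continuous_on UNIV \<phi>" unfolding \<phi>_def by (intro continuous_intros cont)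
  have cont_\<phi>': "continuous_on X (\<lambda>t. \<phi> (g t))" if "continuous_on X g" for X and g :: "real \<Rightarrow> real"
    using continuous_on_compose2[OF cont_\<phi> that] by auto
  have Re_int: "Re (LINT x|lborel. f x) = integral {a..b} \<phi>" if ab: "a \<le> - R" "R \<le> b" for a b
  proof -
    have 0: "f x = 0" if "x \<notin> {a..b}" for x using that ab by (intro supp) auto
    then have "integrable lborel f" using cont by (intro integrable_continuous_compact_support)
    then have "Re (LINT x|lborel. f x) = (LINT x|lborel. \<phi> x)" by (simp add: \<phi>_def)
    also have "\<dots> = integral {a..b} \<phi>"
      using 0 by (intro lborel_integral_compact_support cont_\<phi>) (simp add: \<phi>_def)
    finally show ?thesis .
  qed
  (* The index interval T leaves a margin of one lattice step h, so that shifts by up to h of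
     lattice points outside T still miss the support. *)
  obtain L :: nat where L: "real L > q * R" using reals_Archimedean2 by blast
  have LR: "real L * h > R" using L q by (simp add: h_def field_simps)
  define T where "T = {- int L..int L}"
  have far: "f x = 0" if "n \<notin> T" "\<bar>x - real_of_int n * h\<bar> \<le> h" for n x
  proof -
    have "\<bar>real_of_int n\<bar> \<ge> real L + 1" using that(1) unfolding T_def by auto
    then have "\<bar>real_of_int n\<bar> * h \<ge> (real L + 1) * h" using h by (intro mult_right_mono) auto
    then have "\<bar>real_of_int n * h\<bar> \<ge> real L * h + h" using h by (simp add: abs_mult algebra_simps)
    then show ?thesis using that(2) LR by (intro supp) linarith
  qed
  (* The right-hand side does not depend on t: it is twice the value of the periodization at 0. *)
  have pointwise: "(\<Sum>n\<in>T. \<phi> (real_of_int n * h + t)) + (\<Sum>n\<in>T. \<phi> (real_of_int n * h - t))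
           \<le> 2 * (\<Sum>n\<in>T. \<phi> (real_of_int n * h))" if "t \<in> {0..h}" for t
    using lattice_sum_shift_le[OF pd, of T q t] that h far unfolding \<phi>_def h_def
    by (auto simp: T_def)
  have T: "(\<Sum>n\<in>T. F n) = (\<Sum>i<2 * L + 1. F (int i - int L))" for F :: "int \<Rightarrow> real"
    by (rule sum.reindex_bij_witness[of _ "\<lambda>i. int i - int L" "\<lambda>n. nat (n + int L)"])
       (auto simp: T_def)
  have right: "integral {0..h} (\<lambda>t. \<Sum>n\<in>T. \<phi> (real_of_int n * h + t)) = Re (LINT x|lborel. f x)"
  proof -
    have "integral {0..h} (\<lambda>t. \<Sum>n\<in>T. \<phi> (real_of_int n * h + t)) =
          (\<Sum>n\<in>T. integral {real_of_int n * h..real_of_int n * h + h} \<phi>)"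
      by (subst integral_sum) (auto simp: T_def integral_shift_Icc
            intro!: integrable_continuous_real cont_\<phi>' continuous_intros)
    also have "\<dots> = (\<Sum>i<2 * L + 1. integral {- real L * h + real i * h..- real L * h + real (Suc i) * h} \<phi>)"
      unfolding T by (simp add: algebra_simps)
    also have "\<dots> = integral {- real L * h..- real L * h + real (2 * L + 1) * h} \<phi>"
      using h by (intro sum_integral_consecutive cont_\<phi>) simp
    also have "\<dots> = Re (LINT x|lborel. f x)"
      using LR h by (intro Re_int[symmetric]) (auto simp: algebra_simps)
    finally show ?thesis .
  qed
  have left: "integral {0..h} (\<lambda>t. \<Sum>n\<in>T. \<phi> (real_of_int n * h - t)) = Re (LINT x|lborel. f x)"
  proof -
    have "integral {0..h} (\<lambda>t. \<Sum>n\<in>T. \<phi> (real_of_int n * h - t)) =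
          (\<Sum>n\<in>T. integral {real_of_int n * h - h..real_of_int n * h} \<phi>)"
      by (subst integral_sum) (auto simp: T_def integral_shift_Icc
            intro!: integrable_continuous_real cont_\<phi>' continuous_intros)
    also have "\<dots> = (\<Sum>i<2 * L + 1. integral {- real (Suc L) * h + real i * h..- real (Suc L) * h + real (Suc i) * h} \<phi>)"
      unfolding T by (simp add: algebra_simps)
    also have "\<dots> = integral {- real (Suc L) * h..- real (Suc L) * h + real (2 * L + 1) * h} \<phi>"
      using h by (intro sum_integral_consecutive cont_\<phi>) simp
    also have "\<dots> = Re (LINT x|lborel. f x)"
      using LR h by (intro Re_int[symmetric]) (auto simp: algebra_simps)
    finally show ?thesis .
  qed
  have "2 * Re (LINT x|lborel. f x) =
      integral {0..h} (\<lambda>t. (\<Sum>n\<in>T. \<phi> (real_of_int n * h + t)) + (\<Sum>n\<in>T. \<phi> (real_of_int n * h - t)))"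
    by (subst integral_add)
       (auto simp: left right intro!: integrable_continuous_real cont_\<phi>' continuous_intros)
  also have "\<dots> \<le> integral {0..h} (\<lambda>t. 2 * (\<Sum>n\<in>T. \<phi> (real_of_int n * h)))"
    by (intro integral_le pointwise)
       (auto intro!: integrable_continuous_real cont_\<phi>' continuous_intros)
  also have "\<dots> = 2 * (h * (\<Sum>n\<in>T. \<phi> (real_of_int n * h)))"
    using h by simp
  also have "(\<Sum>n\<in>T. \<phi> (real_of_int n * h)) = (\<Sum>n\<in>S. \<phi> (real_of_int n * h))"
  proof -
    have "\<phi> (real_of_int n * h) = 0" if "n \<notin> T \<or> n \<notin> S" for n
      using that far[of n "real_of_int n * h"] S(2)[of n] h by (auto simp: \<phi>_def h_def)
    then show ?thesis using S(1)
      by (intro sum.mono_neutral_cong) (auto simp: T_def)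
  qed
  finally show ?thesis using q by (simp add: \<phi>_def h_def field_simps)
qed


section \<open>Interpolation\<close>

definition hat :: "real \<Rightarrow> real" where
  "hat x = max 0 (1 - \<bar>x\<bar>)"

lemma continuous_on_hat [continuous_intros]:
  "continuous_on S g \<Longrightarrow> continuous_on S (\<lambda>x. hat (g x))"
  unfolding hat_def by (intro continuous_intros)

lemma has_bochner_integral_hat: "has_bochner_integral lborel hat 1"
proof -
  have cont: "continuous_on S hat" for S by (intro continuous_on_hat continuous_intros)
  have supp: "hat x = 0" if "x \<notin> {-1..1}" for x using that by (auto simp: hat_def)
  have "((\<lambda>x. 1 + x) has_integral (0 + 0\<^sup>2 / 2) - (- 1 + (- 1)\<^sup>2 / 2)) {-1..0::real}"
    by (rule fundamental_theorem_of_calculus)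
       (auto intro!: derivative_eq_intros simp: has_real_derivative_iff_has_vector_derivative[symmetric])
  then have "(hat has_integral (0 + 0\<^sup>2 / 2) - (- 1 + (- 1)\<^sup>2 / 2)) {-1..0}"
    by (rule has_integral_eq[rotated]) (auto simp: hat_def)
  then have 1: "(hat has_integral 1 / 2) {-1..0}" by simp
  have "((\<lambda>x. 1 - x) has_integral (1 - 1\<^sup>2 / 2) - (0 - 0\<^sup>2 / 2)) {0..1::real}"
    by (rule fundamental_theorem_of_calculus)
       (auto intro!: derivative_eq_intros simp: has_real_derivative_iff_has_vector_derivative[symmetric])
  then have "(hat has_integral (1 - 1\<^sup>2 / 2) - (0 - 0\<^sup>2 / 2)) {0..1}"
    by (rule has_integral_eq[rotated]) (auto simp: hat_def)
  then have 2: "(hat has_integral 1 / 2) {0..1}" by simp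
  have "(hat has_integral 1) {-1..1}"
    using has_integral_combine[OF _ _ 1 2] by simp
  moreover have "(LINT x|lborel. hat x) = integral {-1..1} hat"
    using supp by (intro lborel_integral_compact_support cont)
  moreover have "integrable lborel hat"
    using supp by (intro integrable_continuous_compact_support[of _ "-1" 1] cont)
  ultimately show ?thesis by (simp add: has_bochner_integral_iff integral_unique)
qed

text \<open>A triangle is the correlation of the indicator of an interval with itself. This formula is what
  makes triangles positive definite.\<close>
lemma has_bochner_integral_window_overlap:
  assumes "w > 0"
  shows "has_bochner_integral lborel
           (\<lambda>u. indicator {s..<s + w} u * indicator {t..<t + w} u) (w * hat ((s - t) / w))"
proof -
  have "(\<lambda>u. indicator {s..<s + w} u * indicator {t..<t + w} u :: real) =
        indicator {max s t..<min s t + w}"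
    by (auto simp: indicator_def fun_eq_iff)
  moreover have "measure lborel {max s t..<min s t + w} = w * hat ((s - t) / w)"
    using assms
    by (cases "max s t \<le> min s t + w")
       (auto simp: hat_def max_def min_def field_simps split: if_splits)
  ultimately show ?thesis
    using has_bochner_integral_real_indicator[of "{max s t..<min s t + w}" lborel]
    by (cases "max s t \<le> min s t + w") auto
qed

lemma positive_definite_seq_sum_nat_nonneg:
  assumes "positive_definite_seq c"
  shows "(\<Sum>a<N. \<Sum>b<N. Z a * cnj (Z b) * c (int a - int b)) \<in> \<real>\<^sub>\<ge>\<^sub>0"
proof -
  have "(\<Sum>m\<in>int ` {..<N}. \<Sum>n\<in>int ` {..<N}. Z (nat m) * cnj (Z (nat n)) * c (m - n)) \<in> \<real>\<^sub>\<ge>\<^sub>0"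
    using assms[unfolded positive_definite_seq_def, rule_format, of "int ` {..<N}" "Z \<circ> nat"] by simp
  then show ?thesis by (simp add: sum.reindex)
qed

lemma has_bochner_integral_nonneg_Reals:
  fixes f :: "'a \<Rightarrow> complex"
  assumes f: "has_bochner_integral M f I" and nonneg: "\<And>x. f x \<in> \<real>\<^sub>\<ge>\<^sub>0"
  shows "I \<in> \<real>\<^sub>\<ge>\<^sub>0"
proof -
  have int: "integrable M f" and I: "I = (LINT x|M. f x)"
    using f by (auto simp: has_bochner_integral_iff)
  have "Re I = (LINT x|M. Re (f x))" "Im I = (LINT x|M. Im (f x))"
    using int by (simp_all add: I)
  then show ?thesis
    using nonneg by (auto simp: complex_nonneg_Reals_iff)
qed

text \<open>
  Replace each triangle by an overlap integral of two windows \<open>W\<close> of length \<open>w\<close>. For a fixed position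
  \<open>u\<close>, the sums of the \<open>z j\<close> over the points whose window, moved back by \<open>a\<close> lattice steps, contains
  \<open>u\<close> form a test vector \<open>Z u\<close> for the sequence \<open>c\<close>, so the integrand is nonnegative. The double sum
  over lattice steps \<open>a, b < N\<close> that arises is a Toeplitz sum, and letting \<open>N\<close> grow leaves the
  quadratic form of the interpolating function.
\<close>
lemma positive_definite_fun_interpolation:
  assumes c: "positive_definite_seq c" and A: "finite A" "\<And>n. n \<notin> A \<Longrightarrow> c n = 0" and w: "w > 0"
  shows "positive_definite_fun (\<lambda>x. \<Sum>n\<in>A. c n * of_real (hat ((q * x - real_of_int n) / w)))"
  unfolding positive_definite_fun_def
proof (intro allI)
  fix m :: nat and x :: "nat \<Rightarrow> real" and z :: "nat \<Rightarrow> complex"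
  define g where "g n = (\<Sum>j<m. \<Sum>k<m. z j * cnj (z k) *
      (c n * of_real (hat ((q * (x j - x k) - real_of_int n) / w))))" for n
  have "(\<Sum>n\<in>A. g n) \<in> \<real>\<^sub>\<ge>\<^sub>0"
  proof (rule sum_nonneg_if_Toeplitz_sums_nonneg)
    fix N
    define W :: "nat \<Rightarrow> nat \<Rightarrow> real \<Rightarrow> real" where
      "W a j = indicator {q * x j - real a..<q * x j - real a + w}" for a j
    define Z where "Z u a = (\<Sum>j<m. z j * of_real (W a j u))" for u a
    have "has_bochner_integral lborel
        (\<lambda>u. \<Sum>a<N. \<Sum>b<N. \<Sum>j<m. \<Sum>k<m. z j * cnj (z k) * c (int a - int b) * of_real (W a j u * W b k u))
        (\<Sum>a<N. \<Sum>b<N. \<Sum>j<m. \<Sum>k<m. z j * cnj (z k) * c (int a - int b) *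
            of_real (w * hat ((q * x j - real a - (q * x k - real b)) / w)))"
      unfolding W_def
      by (intro has_bochner_integral_sum has_bochner_integral_mult_right
          has_bochner_integral_of_real has_bochner_integral_window_overlap w)
    also have "(\<lambda>u. \<Sum>a<N. \<Sum>b<N. \<Sum>j<m. \<Sum>k<m. z j * cnj (z k) * c (int a - int b) * of_real (W a j u * W b k u)) =
       (\<lambda>u. \<Sum>a<N. \<Sum>b<N. Z u a * cnj (Z u b) * c (int a - int b))"
      unfolding Z_def cnj_sum sum_product unfolding sum_distrib_right
      by (intro ext sum.cong refl) simp
    also have "(\<Sum>a<N. \<Sum>b<N. \<Sum>j<m. \<Sum>k<m. z j * cnj (z k) * c (int a - int b) *
            of_real (w * hat ((q * x j - real a - (q * x k - real b)) / w)))
          = of_real w * (\<Sum>a<N. \<Sum>b<N. g (int a - int b))"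
      unfolding g_def sum_distrib_left
      by (intro sum.cong refl) (simp add: algebra_simps)
    finally have "of_real w * (\<Sum>a<N. \<Sum>b<N. g (int a - int b)) \<in> \<real>\<^sub>\<ge>\<^sub>0"
      by (rule has_bochner_integral_nonneg_Reals) (rule positive_definite_seq_sum_nat_nonneg[OF c])
    then show "(\<Sum>a<N. \<Sum>b<N. g (int a - int b)) \<in> \<real>\<^sub>\<ge>\<^sub>0"
      using w by (simp add: complex_nonneg_Reals_iff zero_le_mult_iff)
  qed (use A in \<open>auto simp: g_def\<close>)
  also have "(\<Sum>n\<in>A. g n) = (\<Sum>j<m. \<Sum>k<m. z j * cnj (z k) *
      (\<Sum>n\<in>A. c n * of_real (hat ((q * (x j - x k) - real_of_int n) / w))))"
    unfolding g_def sum_distrib_left by (rule trans[OF sum.swap]) (rule sum.cong[OF refl], rule sum.swap)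
  finally show "(\<Sum>j<m. \<Sum>k<m. z j * cnj (z k) *
      (\<Sum>n\<in>A. c n * of_real (hat ((q * (x j - x k) - real_of_int n) / w)))) \<in> \<real>\<^sub>\<ge>\<^sub>0" .
qed

lemma integral_interpolation:
  fixes c :: "int \<Rightarrow> complex"
  assumes "w > 0" "q > 0"
  shows "(LINT x|lborel. (\<Sum>n\<in>A. c n * of_real (hat ((q * x - real_of_int n) / w)))) =
         of_real (w / q) * (\<Sum>n\<in>A. c n)"
proof -
  have "has_bochner_integral lborel (\<lambda>x. hat ((q * x - real_of_int n) / w)) (w / q)" for n
    using has_bochner_integral_hat assms
      lborel_has_bochner_integral_real_affine_iff[of "q / w" hat 1 "- real_of_int n / w"]
    by (simp add: field_simps)
  then have "has_bochner_integral lborel (\<lambda>x. \<Sum>n\<in>A. c n * of_real (hat ((q * x - real_of_int n) / w)))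
      (\<Sum>n\<in>A. c n * of_real (w / q))"
    by (intro has_bochner_integral_sum has_bochner_integral_mult_right has_bochner_integral_of_real)
  then show ?thesis
    by (simp only: has_bochner_integral_iff sum_distrib_right[symmetric] mult.commute)
qed

section \<open>The two Turan constants\<close>

text \<open>An interval around \<open>n / q\<close> that leaves \<open>\<Omega>\<close> meets the boundary by connectedness; the only
  lattice point within distance less than \<open>1 / q\<close> of \<open>n / q\<close> is \<open>n / q\<close> itself, which lies in the open
  set \<open>\<Omega>\<close> and hence not on its boundary.\<close>
lemma lattice_cell_subset:
  fixes \<Omega> :: "real set"
  assumes "open \<Omega>" and q: "q > 0"
    and fr: "\<And>x. x \<in> frontier \<Omega> \<Longrightarrow> \<exists>k :: int. x = real_of_int k / q"
    and n: "real_of_int n / q \<in> \<Omega>" and x: "\<bar>q * x - real_of_int n\<bar> < 1"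
  shows "x \<in> \<Omega>"
proof (rule ccontr)
  assume "x \<notin> \<Omega>"
  let ?B = "ball (real_of_int n / q) (1 / q)"
  have dist: "y \<in> ?B \<longleftrightarrow> \<bar>q * y - real_of_int n\<bar> < 1" for y
  proof -
    have "q * y - real_of_int n = q * (y - real_of_int n / q)" using q by (simp add: algebra_simps)
    then show ?thesis using q by (simp add: dist_real_def abs_mult abs_minus_commute field_simps)
  qed
  have "?B \<inter> frontier \<Omega> \<noteq> {}"
    using connected_Int_frontier[of ?B \<Omega>] n \<open>x \<notin> \<Omega>\<close> q x dist[of x] centre_in_ball[of "real_of_int n / q" "1 / q"]
    by (metis connected_ball disjoint_iff Diff_iff empty_iff zero_less_divide_1_iff)
  then obtain k :: int where k: "real_of_int k / q \<in> ?B" "real_of_int k / q \<in> frontier \<Omega>"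
    using fr by blast
  have "\<bar>real_of_int (k - n)\<bar> < 1" using k(1) q unfolding dist by simp
  then have "k = n" by linarith
  then show False using k(2) n \<open>open \<Omega>\<close> by (simp add: frontier_def interior_open)
qed

text \<open>The strict inequality \<open>w < 1\<close> matters here: closed triangles of half-width exactly \<open>1 / q\<close> may
  touch the boundary of \<open>\<Omega>\<close>.\<close>
lemma closure_support_interpolation_subset:
  assumes "w > 0" "w < 1" "q > 0" "finite A"
    and "\<And>n x. n \<in> A \<Longrightarrow> \<bar>q * x - real_of_int n\<bar> < 1 \<Longrightarrow> x \<in> \<Omega>"
  shows "closure {x. (\<Sum>n\<in>A. c n * complex_of_real (hat ((q * x - real_of_int n) / w))) \<noteq> 0} \<subseteq> \<Omega>"
proof -
  let ?C = "\<Union>n\<in>A. {x. \<bar>q * x - real_of_int n\<bar> \<le> w}"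
  have "closed ?C"
    using assms(4) by (intro closed_UN ballI closed_Collect_le continuous_intros)
  moreover have "{x. (\<Sum>n\<in>A. c n * complex_of_real (hat ((q * x - real_of_int n) / w))) \<noteq> 0} \<subseteq> ?C"
  proof clarify
    fix x assume "(\<Sum>n\<in>A. c n * complex_of_real (hat ((q * x - real_of_int n) / w))) \<noteq> 0"
    then obtain n where "n \<in> A" "hat ((q * x - real_of_int n) / w) \<noteq> 0"
      by (force elim: sum.not_neutral_contains_not_neutral)
    then show "x \<in> ?C" using assms(1) by (force simp: hat_def max_def field_simps split: if_splits)
  qed
  ultimately have "closure {x. (\<Sum>n\<in>A. c n * complex_of_real (hat ((q * x - real_of_int n) / w))) \<noteq> 0} \<subseteq> ?C"
    by (rule closure_minimal[rotated])
  then show ?thesis using assms(2,5) by fastforce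
qed

theorem corollary2p7:
  fixes \<Omega> :: "real set" and q :: int
  assumes "\<exists>I :: (real \<times> real) set. finite I \<and> \<Omega> = (\<Union>(a, b)\<in>I. {a<..<b})"
    and "uminus ` \<Omega> = \<Omega>"
    and "0 \<in> interior \<Omega>"
    and "q \<ge> 1"
    and "\<forall>x\<in>frontier \<Omega>. \<exists>k :: int. x = real_of_int k / real_of_int q"
  shows "turan_real \<Omega> =
           1 / real_of_int q * turan_int {n :: int. real_of_int n / real_of_int q \<in> interior \<Omega>}"
proof -
  define Q where "Q = real_of_int q"
  have Q: "Q > 0" using assms(4) by (simp add: Q_def)
  have "open \<Omega>" "bounded \<Omega>" using assms(1) by (auto intro!: open_UN)
  then have int: "interior \<Omega> = \<Omega>" by (simp add: interior_open)
  obtain R where R: "\<And>x. x \<in> \<Omega> \<Longrightarrow> \<bar>x\<bar> \<le> R"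
    using \<open>bounded \<Omega>\<close> by (auto simp: bounded_iff)
  define A where "A = {n :: int. real_of_int n / Q \<in> \<Omega>}"
  have "A \<subseteq> {- \<lceil>R * Q\<rceil>..\<lceil>R * Q\<rceil>}"
  proof
    fix n assume "n \<in> A"
    then have "\<bar>real_of_int n\<bar> \<le> R * Q" using R[of "real_of_int n / Q"] Q by (simp add: A_def field_simps)
    then show "n \<in> {- \<lceil>R * Q\<rceil>..\<lceil>R * Q\<rceil>}" by (simp add: abs_le_iff) linarith
  qed
  then have finA: "finite A" by (rule finite_subset) simp
  have symA: "- n \<in> A" if "n \<in> A" for n
    using that assms(2) by (force simp: A_def)
  have A0: "0 \<in> A" using assms(3) by (simp add: A_def int)
  define SR where "SR = {Re (LINT x|lborel. f x) | f :: real \<Rightarrow> complex.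
            continuous_on UNIV f \<and> positive_definite_fun f \<and> f 0 = 1 \<and>
            closure {x. f x \<noteq> 0} \<subseteq> \<Omega>}"
  define SZ where "SZ = {Re (\<Sum>n\<in>A. c n) | c :: int \<Rightarrow> complex.
            positive_definite_seq c \<and> c 0 = 1 \<and> (\<forall>n. n \<notin> A \<longrightarrow> c n = 0)}"
  have bddZ: "bdd_above SZ" unfolding SZ_def using finA symA by (rule bdd_above_turan_int)
  have "Re (\<Sum>n\<in>A. if n = 0 then 1 else 0) \<in> SZ"
    unfolding SZ_def
  proof (intro CollectI exI conjI)
    show "positive_definite_seq (\<lambda>n. if n = 0 then 1 else 0)"
      by (rule positive_definite_seq_delta)
  qed (use A0 in auto)
  then have neZ: "SZ \<noteq> {}" by blast
  have upper: "Q * r \<le> Sup SZ" if "r \<in> SR" for r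
  proof -
    from that obtain f where f: "continuous_on UNIV f" "positive_definite_fun f" "f 0 = 1"
      "closure {x. f x \<noteq> 0} \<subseteq> \<Omega>" and r: "r = Re (LINT x|lborel. f x)"
      unfolding SR_def by blast
    have supp: "f x = 0" if "x \<notin> \<Omega>" for x
      using f(4) that closure_subset[of "{x. f x \<noteq> 0}"] by blast
    have "Q * r \<le> Re (\<Sum>n\<in>A. f (real_of_int n / Q))"
      unfolding r
    proof (rule integral_le_lattice_sum[OF f(1,2) Q _ finA])
      show "f x = 0" if "\<bar>x\<bar> > R" for x using that R[of x] by (intro supp) auto
    qed (simp add: A_def supp)
    moreover have "Re (\<Sum>n\<in>A. f (real_of_int n / Q)) \<in> SZ"
      unfolding SZ_def
    proof (intro CollectI exI conjI)
      show "positive_definite_seq (\<lambda>n. f (real_of_int n / Q))"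
        by (rule positive_definite_seq_sample[OF f(2)])
    qed (simp_all add: f(3) supp A_def)
    then have "Re (\<Sum>n\<in>A. f (real_of_int n / Q)) \<le> Sup SZ"
      using bddZ by (rule cSup_upper)
    ultimately show ?thesis by linarith
  qed
  have lower: "w * s / Q \<in> SR" if "s \<in> SZ" and w: "0 < w" "w < 1" for s w
  proof -
    from \<open>s \<in> SZ\<close> obtain c where c: "positive_definite_seq c" "c 0 = 1" "\<And>n. n \<notin> A \<Longrightarrow> c n = 0"
      and s: "s = Re (\<Sum>n\<in>A. c n)"
      unfolding SZ_def by blast
    define f where "f x = (\<Sum>n\<in>A. c n * complex_of_real (hat ((Q * x - real_of_int n) / w)))" for x
    have cont: "continuous_on UNIV f"
      unfolding f_def using w by (intro continuous_intros) auto
    have pd: "positive_definite_fun f"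
      unfolding f_def using c finA w(1) by (intro positive_definite_fun_interpolation)
    have f0: "f 0 = 1"
    proof -
      have "hat (- real_of_int n / w) = (if n = 0 then 1 else 0)" for n
      proof (cases "n = 0")
        case False
        then have "\<bar>real_of_int n\<bar> \<ge> w" using w by linarith
        then show ?thesis using False w by (simp add: hat_def field_simps)
      qed (simp add: hat_def)
      then have "f 0 = (\<Sum>n\<in>A. if n = 0 then c n else 0)"
        unfolding f_def by (intro sum.cong) auto
      then show ?thesis using finA A0 c(2) by simp
    qed
    have supp: "closure {x. f x \<noteq> 0} \<subseteq> \<Omega>"
      unfolding f_def
    proof (rule closure_support_interpolation_subset[OF w Q finA])
      fix n x assume "n \<in> A" "\<bar>Q * x - real_of_int n\<bar> < 1"
      then show "x \<in> \<Omega>"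
        using lattice_cell_subset[OF \<open>open \<Omega>\<close> Q] assms(5) by (simp add: A_def Q_def)
    qed
    have int_f: "Re (LINT x|lborel. f x) = w * s / Q"
      unfolding f_def integral_interpolation[OF w(1) Q] s by simp
    show ?thesis
      unfolding SR_def using cont pd f0 supp int_f[symmetric] by blast
  qed
  have bddR: "bdd_above SR"
    using upper Q by (intro bdd_aboveI[of _ "Sup SZ / Q"]) (simp add: pos_le_divide_eq mult.commute)
  have neR: "SR \<noteq> {}" using lower[of _ "1 / 2"] neZ by fastforce
  have "Sup SR \<le> Sup SZ / Q"
    using upper Q by (intro cSup_least neR) (simp add: pos_le_divide_eq mult.commute)
  moreover have "s \<le> Q * Sup SR" if "s \<in> SZ" for s
  proof (rule field_le_mult_one_interval)
    fix w :: real assume w: "0 < w" "w < 1"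
    have "w * s / Q \<le> Sup SR" by (rule cSup_upper[OF lower[OF that w] bddR])
    then show "w * s \<le> Q * Sup SR" using Q by (simp add: pos_divide_le_eq mult.commute)
  qed
  then have "Sup SZ \<le> Q * Sup SR" using neZ by (intro cSup_least)
  ultimately have "Sup SR = 1 / Q * Sup SZ"
    using Q by (intro antisym) (simp_all add: pos_le_divide_eq pos_divide_le_eq mult.commute)
  then show ?thesis
    unfolding turan_real_def turan_int_def int
    by (simp add: SR_def SZ_def A_def Q_def)
qed

end
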